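(* Let $m\ge1$ be an integer and $r\in\mathbb{Z}$. Assume that the Riemann-Hilbert problem (Y1)–(Y3) described in the context is solvable, with solution $\boldsymbol{Y}_m(z;r)$. Then $$\boldsymbol{Y}_m(z;r)=\boldsymbol{Y}_m(-z;r)\begin{pmatrix}1&0&0\\2z&1&0\\0&0&1\end{pmatrix}.$$ In particular, for each $j=1,2,3$, the entries $Y_{jk}$ of $\boldsymbol{Y}_m$ satisfy $$Y_{j2}(z;r)=\frac{Y_{j1}(z;r)-Y_{j1}(-z;r)}{2z}.$$
   Context: $\mathbb{T}$ is the unit circle, oriented counterclockwise; the subscripts $+$ and $-$ denote (continuous) boundary values on $\mathbb{T}$ from the inside and the outside respectively. $w$ is a weight function on $\mathbb{T}$. The Riemann-Hilbert problem for $\boldsymbol{Y}_m(z;r)$: (Y1) $\boldsymbol{Y}_m(\cdot;r):\mathbb{C}\setminus\mathbb{T}\to\mathbb{C}^{3\times3}$ is holomorphic. (Y2) For $z\in\mathbb{T}$, $\boldsymbol{Y}_{m,+}(z;r)=\boldsymbol{Y}_{m,-}(z;r)\begin{pmatrix}1&0&j_1(z;m,r)\\0&1&j_2(z;m,r)\\0&0&1\end{pmatrix}$, where $j_1(z;m,r)=z^{-4m-r+4}\left[w(z)+(-1)^r w(-z)\right]$ and $j_2(z;m,r)=2(-1)^{r+1}z^{-4m-r+5}w(-z)$. (Y3) As $z\to\infty$, $$\boldsymbol{Y}_m(z;r)=\left(I+\frac{\overset{\infty}{\boldsymbol{Y}}_1(m,r)}{z}+\frac{\overset{\infty}{\boldsymbol{Y}}_2(m,r)}{z^2}+O(z^{-3})\right)\operatorname{diag}\left(z^{2m},z^{2m-2},z^{-4m+2}\right),$$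 where $\overset{\infty}{\boldsymbol{Y}}_1(m,r)$ is the matrix with $(2,1)$ entry $1$ and all other entries $0$, and the $(3,1)$ entry of $\overset{\infty}{\boldsymbol{Y}}_2(m,r)$ is nonzero. *)

theory Defs
  imports "HOL-Complex_Analysis.Complex_Analysis" "HOL-Library.Landau_Symbols"
begin

abbreviation unit_circle :: "complex set" where
  "unit_circle \<equiv> sphere 0 1"

(* A weight on the unit circle is an arbitrary complex-valued function w. Only its values on the
   circle matter; no positivity or regularity is imposed, so every class of weights is covered. *)

definition j1 :: "(complex \<Rightarrow> complex) \<Rightarrow> int \<Rightarrow> int \<Rightarrow> complex \<Rightarrow> complex" where
  "j1 w m r z = z powi (- 4 * m - r + 4) * (w z + (- 1) powi r * w (- z))"

definition j2 :: "(complex \<Rightarrow> complex) \<Rightarrow> int \<Rightarrow> int \<Rightarrow> complex \<Rightarrow> complex" where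
  "j2 w m r z = 2 * (- 1) powi (r + 1) * z powi (- 4 * m - r + 5) * w (- z)"

definition jump_matrix :: "(complex \<Rightarrow> complex) \<Rightarrow> int \<Rightarrow> int \<Rightarrow> complex \<Rightarrow> complex^3^3" where
  "jump_matrix w m r z =
     vector [vector [1, 0, j1 w m r z],
             vector [0, 1, j2 w m r z],
             vector [0, 0, 1]]"

definition diag3 :: "complex \<Rightarrow> complex \<Rightarrow> complex \<Rightarrow> complex^3^3" where
  "diag3 a b c = vector [vector [a, 0, 0], vector [0, b, 0], vector [0, 0, c]]"

definition rhp_holomorphic :: "(complex \<Rightarrow> complex^3^3) \<Rightarrow> bool" where
  "rhp_holomorphic Y \<longleftrightarrow> (\<forall>i j. (\<lambda>z. Y z $ i $ j) holomorphic_on (- unit_circle))"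

(* Since the circle is oriented counterclockwise, the + side is the unit disc and the - side is
   its exterior. The boundary values Yp and Ym are unrestricted limits from the two sides. *)
definition rhp_jump ::
  "(complex \<Rightarrow> complex) \<Rightarrow> int \<Rightarrow> int \<Rightarrow> (complex \<Rightarrow> complex^3^3) \<Rightarrow> bool" where
  "rhp_jump w m r Y \<longleftrightarrow>
     (\<exists>Yp Ym.
        continuous_on unit_circle Yp \<and> continuous_on unit_circle Ym \<and>
        (\<forall>z\<in>unit_circle.
           (Y \<longlongrightarrow> Yp z) (at z within ball 0 1) \<and>
           (Y \<longlongrightarrow> Ym z) (at z within - cball 0 1) \<and>
           Yp z = Ym z ** jump_matrix w m r z))"

(* mat c ** A is the product of the scalar c with the matrix A; E is the O(z^(-3)) remainder. *)
definition rhp_asymptotics :: "int \<Rightarrow> (complex \<Rightarrow> complex^3^3) \<Rightarrow> bool" where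
  "rhp_asymptotics m Y \<longleftrightarrow>
     (\<exists>Y1 Y2 E.
        Y1 = vector [vector [0, 0, 0], vector [1, 0, 0], vector [0, 0, 0]] \<and>
        Y2 $ 3 $ 1 \<noteq> 0 \<and>
        (\<forall>i j. (\<lambda>z. E z $ i $ j) \<in> O[at_infinity](\<lambda>z. z powi (- 3))) \<and>
        (\<forall>\<^sub>F z in at_infinity.
           Y z = (mat 1 + mat (1 / z) ** Y1 + mat (1 / z\<^sup>2) ** Y2 + E z)
                 ** diag3 (z powi (2 * m)) (z powi (2 * m - 2)) (z powi (- 4 * m + 2))))"

definition solves_rhp ::
  "(complex \<Rightarrow> complex) \<Rightarrow> int \<Rightarrow> int \<Rightarrow> (complex \<Rightarrow> complex^3^3) \<Rightarrow> bool" where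
  "solves_rhp w m r Y \<longleftrightarrow> rhp_holomorphic Y \<and> rhp_jump w m r Y \<and> rhp_asymptotics m Y"

end

theory Submission
  imports Defs
begin

text \<open>
  The matrix \<open>Y (- z) ** L z\<close>, with \<open>L z\<close> the unipotent factor of the theorem, solves the same
  Riemann-Hilbert problem as \<open>Y\<close>, and that problem has at most one solution.

  \<^emph>\<open>Same problem.\<close> Conjugation turns the reflected jump back into the original one,
  \<open>J (- z) ** L z = L z ** J z\<close>; for the third column this is the pair of identities
  \<open>j1 (- z) = j1 z\<close> and \<open>j2 (- z) = 2 z j1 z + j2 z\<close>. They hold because the power of \<open>z\<close> in \<open>j1\<close>
  has the parity of \<open>r\<close>: its sign under \<open>z \<mapsto> - z\<close> cancels against the sign \<open>(-1)\<close> to the \<open>r\<close> that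
  appears when \<open>w z\<close> and \<open>w (- z)\<close> change places. At infinity the diagonal powers \<open>z powi (2 m)\<close>,
  \<open>z powi (2 m - 2)\<close>, \<open>z powi (- 4 m + 2)\<close> are even, and moving \<open>L z\<close> to the
  left of their diagonal matrix divides its lower entry \<open>2 z\<close> by \<open>z\<^sup>2\<close>, so that what arrives there tends to the identity (\<open>jump_problem_reflect\<close>).

  \<^emph>\<open>Uniqueness.\<close> The determinant of a matrix function whose jump has determinant one has no jump
  at all, so it continues to an entire function, and Liouville's theorem makes it constant
  (\<open>jump_problem_det\<close>). Besides \<open>det A = 1\<close> this applies to every matrix obtained from a solution
  \<open>A\<close> by replacing one of its rows with a row of another solution \<open>B\<close>, since such a mixture has the
  same jump. By Cramer's rule these determinants are the coordinates of the rows of \<open>B\<close> in the basis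
  of the rows of \<open>A\<close>; their limits at infinity say that the coordinates are those of the unit vectors
  (\<open>jump_problem_unique\<close>).
\<close>

(* Formal power series use the same infix for their coefficients, which would make every matrix
   entry ambiguous. *)
no_notation fps_nth (infixl \<open>$\<close> 75)

section \<open>Continuation across the unit circle\<close>

text \<open>
  Under \<open>s \<mapsto> u * exp s\<close> the preimage of the circle is a vertical line, so that the known result for
  lines applies to the composition with \<open>f\<close>. The factor \<open>u\<close> keeps the principal logarithm away from
  its branch cut near \<open>u\<close>, and composing with it brings holomorphy back to \<open>f\<close> there.
\<close>

lemma holomorphic_on_paste_across_unit_circle:
  fixes f :: "complex \<Rightarrow> complex"
  assumes hol: "f holomorphic_on (- unit_circle)" and cont: "continuous_on UNIV f"
  shows "f holomorphic_on UNIV"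
proof -
  have local_hol: "f field_differentiable (at u)" if u: "u \<noteq> 0" for u
  proof -
    define g where "g = (\<lambda>s. f (u * exp s))"
    have off_line: "g holomorphic_on S" if S: "\<And>s. s \<in> S \<Longrightarrow> Re s \<noteq> - ln (norm u)" for S
    proof -
      have "norm (u * exp s) \<noteq> 1" if "s \<in> S" for s
      proof
        assume "norm (u * exp s) = 1"
        then have "exp (ln (norm u) + Re s) = 1"
          using u by (simp add: norm_mult exp_add)
        then show False
          using S[OF that] by simp
      qed
      then have "(\<lambda>s. u * exp s) ` S \<subseteq> - unit_circle"
        by auto
      with hol have "(f \<circ> (\<lambda>s. u * exp s)) holomorphic_on S"
        by (intro holomorphic_on_compose_gen[where t = "- unit_circle"] holomorphic_intros) auto
      then show ?thesis
        by (simp add: g_def comp_def)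
    qed
    have g_hol: "g holomorphic_on UNIV"
    proof (rule holomorphic_on_paste_across_line[where d = 1 and k = "- ln (norm u)"])
      show "continuous_on UNIV g"
        unfolding g_def by (intro continuous_on_compose2[OF cont] continuous_intros) auto
    qed (auto intro!: off_line)
    have Ln_hol: "(\<lambda>z. Ln (z / u)) holomorphic_on {z. z / u \<notin> \<real>\<^sub>\<le>\<^sub>0}"
      using u by (intro holomorphic_intros) auto
    have "open {z. z / u \<notin> \<real>\<^sub>\<le>\<^sub>0}"
    proof -
      have "open ((\<lambda>z. z / u) -` (- \<real>\<^sub>\<le>\<^sub>0))"
        using u by (intro continuous_open_vimage continuous_intros) auto
      then show ?thesis
        by (simp add: vimage_def)
    qed
    moreover have "(g \<circ> (\<lambda>z. Ln (z / u))) holomorphic_on {z. z / u \<notin> \<real>\<^sub>\<le>\<^sub>0}"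
      by (rule holomorphic_on_compose[OF Ln_hol]) (rule holomorphic_on_subset[OF g_hol], simp)
    then have "f holomorphic_on {z. z / u \<notin> \<real>\<^sub>\<le>\<^sub>0}"
    proof (rule holomorphic_transform)
      fix z assume "z \<in> {z. z / u \<notin> \<real>\<^sub>\<le>\<^sub>0}"
      then have "z \<noteq> 0" by auto
      then show "(g \<circ> (\<lambda>z. Ln (z / u))) z = f z"
        using u by (simp add: g_def)
    qed
    moreover have "u \<in> {z. z / u \<notin> \<real>\<^sub>\<le>\<^sub>0}"
      using u by simp
    ultimately show ?thesis
      using holomorphic_on_imp_differentiable_at by blast
  qed
  moreover have "f field_differentiable (at 0)"
  proof -
    have "f holomorphic_on ball 0 1"
      by (rule holomorphic_on_subset[OF hol]) auto
    then show ?thesis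
      using holomorphic_on_imp_differentiable_at by force
  qed
  ultimately show ?thesis
    by (metis holomorphic_on_def field_differentiable_at_within)
qed

text \<open>
  The hypothesis on the boundary values makes \<open>f\<close> continuous once the values on the circle are replaced
  by \<open>b\<close>; the result is entire, and Liouville's theorem applies.
\<close>

lemma constant_if_no_jump_across_unit_circle:
  fixes f :: "complex \<Rightarrow> complex"
  assumes hol: "f holomorphic_on (- unit_circle)"
    and cont: "continuous_on unit_circle b"
    and inside: "\<And>z. z \<in> unit_circle \<Longrightarrow> (f \<longlongrightarrow> b z) (at z within ball 0 1)"
    and outside: "\<And>z. z \<in> unit_circle \<Longrightarrow> (f \<longlongrightarrow> b z) (at z within - cball 0 1)"
    and lim: "(f \<longlongrightarrow> c) at_infinity"
    and z: "z \<notin> unit_circle"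
  shows "f z = c"
proof -
  define F where "F = (\<lambda>z. if z \<in> unit_circle then b z else f z)"
  have F_off: "F z = f z" if "z \<in> - unit_circle" for z
    using that by (simp add: F_def)
  have F_hol: "F holomorphic_on (- unit_circle)"
    using holomorphic_transform[OF hol] F_off by metis
  have "isCont F x" for x
  proof (cases "x \<in> unit_circle")
    case False
    moreover have "open (- unit_circle)"
      by (simp add: open_Compl)
    ultimately show ?thesis
      using F_hol by (meson ComplI continuous_on_eq_continuous_at holomorphic_on_imp_continuous_on)
  next
    case True
    have "(F \<longlongrightarrow> b x) (at x within ball 0 1)"
      by (rule Lim_transform_eventually[OF inside[OF True]])
         (auto simp: eventually_at_filter F_def intro!: always_eventually)
    moreover have "(F \<longlongrightarrow> b x) (at x within - cball 0 1)"
      by (rule Lim_transform_eventually[OF outside[OF True]])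
         (auto simp: eventually_at_filter F_def intro!: always_eventually)
    moreover have "(F \<longlongrightarrow> b x) (at x within unit_circle)"
    proof (rule Lim_transform_eventually)
      show "(b \<longlongrightarrow> b x) (at x within unit_circle)"
        using cont True by (simp add: continuous_on_def)
    qed (auto simp: eventually_at_filter F_def intro!: always_eventually)
    ultimately have "(F \<longlongrightarrow> b x) (at x within (ball 0 1 \<union> - cball 0 1) \<union> unit_circle)"
      by (intro Lim_Un)
    moreover have "(ball 0 1 \<union> - cball 0 1) \<union> unit_circle = (UNIV :: complex set)"
      by auto
    ultimately show ?thesis
      using True by (simp add: isCont_def F_def)
  qed
  then have "continuous_on UNIV F"
    by (simp add: continuous_at_imp_continuous_on)
  with F_hol have "F holomorphic_on UNIV"
    by (rule holomorphic_on_paste_across_unit_circle)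
  moreover have "(F \<longlongrightarrow> c) at_infinity"
  proof (rule Lim_transform_eventually[OF lim])
    show "\<forall>\<^sub>F z in at_infinity. f z = F z"
      unfolding eventually_at_infinity by (rule exI[of _ 2]) (auto simp: F_def)
  qed
  ultimately have "F z = c"
    by (rule Liouville_weak)
  then show ?thesis
    using z by (simp add: F_def)
qed


section \<open>Uniqueness for jump problems with unimodular jump\<close>

text \<open>
  The limit \<open>C\<close> of the normalized solution \<open>A ** D\<^sup>-\<^sup>1\<close> at infinity is a parameter rather than the
  identity because exchanging a row of a solution for another row changes it. Convergence of the
  normalized solution, phrased through the factor \<open>N\<close>, is the form in which Liouville's theorem uses
  the growth condition.
\<close>

definition jump_problem ::
  "(complex \<Rightarrow> complex^'n^'n) \<Rightarrow> (complex \<Rightarrow> complex^'n^'n) \<Rightarrow> complex^'n^'n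
     \<Rightarrow> (complex \<Rightarrow> complex^'n^'n) \<Rightarrow> bool" where
  "jump_problem J D C A \<longleftrightarrow>
     (\<forall>i j. (\<lambda>z. A z $ i $ j) holomorphic_on (- unit_circle)) \<and>
     (\<exists>Ap Am.
        continuous_on unit_circle Ap \<and> continuous_on unit_circle Am \<and>
        (\<forall>z\<in>unit_circle.
           (A \<longlongrightarrow> Ap z) (at z within ball 0 1) \<and>
           (A \<longlongrightarrow> Am z) (at z within - cball 0 1) \<and>
           Ap z = Am z ** J z)) \<and>
     (\<exists>N. (N \<longlongrightarrow> C) at_infinity \<and> (\<forall>\<^sub>F z in at_infinity. A z = N z ** D z))"

lemma tendsto_matrix_mult:
  fixes A B :: "'a \<Rightarrow> complex^'n^'n"
  assumes "(A \<longlongrightarrow> a) F" "(B \<longlongrightarrow> b) F"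
  shows "((\<lambda>x. A x ** B x) \<longlongrightarrow> a ** b) F"
  unfolding matrix_matrix_mult_def by (intro tendsto_intros assms)

lemma continuous_on_matrix_mult:
  fixes A B :: "'a::topological_space \<Rightarrow> complex^'n^'n"
  assumes "continuous_on S A" "continuous_on S B"
  shows "continuous_on S (\<lambda>x. A x ** B x)"
  using assms by (auto simp: continuous_on_def intro: tendsto_matrix_mult)

lemma tendsto_det:
  fixes A :: "'a \<Rightarrow> complex^'n^'n"
  assumes "(A \<longlongrightarrow> a) F"
  shows "((\<lambda>x. det (A x)) \<longlongrightarrow> det a) F"
  unfolding det_def by (intro tendsto_intros assms)

lemma holomorphic_on_det:
  fixes A :: "complex \<Rightarrow> complex^'n^'n"
  assumes "\<And>i j. (\<lambda>z. A z $ i $ j) holomorphic_on S"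
  shows "(\<lambda>z. det (A z)) holomorphic_on S"
  unfolding det_def by (intro holomorphic_intros assms)

text \<open>
  The determinant turns the matrix jump into multiplication by \<open>det (J z) = 1\<close> and the growth
  into multiplication by \<open>det (D z) = 1\<close>, so neither is left.
\<close>

theorem jump_problem_det:
  fixes A :: "complex \<Rightarrow> complex^'n^'n"
  assumes A: "jump_problem J D C A"
    and J: "\<And>z. z \<in> unit_circle \<Longrightarrow> det (J z) = 1"
    and D: "\<forall>\<^sub>F z in at_infinity. det (D z) = 1"
    and z: "z \<notin> unit_circle"
  shows "det (A z) = det C"
proof -
  from A obtain Ap Am N where
    hol: "\<And>i j. (\<lambda>z. A z $ i $ j) holomorphic_on (- unit_circle)"
    and Am: "continuous_on unit_circle Am"
    and jump: "\<And>z. z \<in> unit_circle \<Longrightarrow>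
      (A \<longlongrightarrow> Ap z) (at z within ball 0 1) \<and>
      (A \<longlongrightarrow> Am z) (at z within - cball 0 1) \<and> Ap z = Am z ** J z"
    and N: "(N \<longlongrightarrow> C) at_infinity" "\<forall>\<^sub>F z in at_infinity. A z = N z ** D z"
    unfolding jump_problem_def by blast
  show ?thesis
  proof (rule constant_if_no_jump_across_unit_circle[where f = "\<lambda>z. det (A z)"
        and b = "\<lambda>z. det (Am z)", OF _ _ _ _ _ z])
    show "(\<lambda>z. det (A z)) holomorphic_on - unit_circle"
      by (rule holomorphic_on_det[OF hol])
    show "continuous_on unit_circle (\<lambda>z. det (Am z))"
      using Am by (auto simp: continuous_on_def intro: tendsto_det)
    show "((\<lambda>z. det (A z)) \<longlongrightarrow> det (Am x)) (at x within ball 0 1)" if "x \<in> unit_circle" for x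
    proof -
      have "det (Ap x) = det (Am x)"
        using jump[OF that] J[OF that] by (simp add: det_mul)
      then show ?thesis
        using jump[OF that] tendsto_det by metis
    qed
    show "((\<lambda>z. det (A z)) \<longlongrightarrow> det (Am x)) (at x within - cball 0 1)" if "x \<in> unit_circle" for x
      using jump[OF that] by (auto intro: tendsto_det)
    show "((\<lambda>z. det (A z)) \<longlongrightarrow> det C) at_infinity"
    proof (rule Lim_transform_eventually[OF tendsto_det[OF N(1)]])
      show "\<forall>\<^sub>F z in at_infinity. det (N z) = det (A z)"
        using N(2) D by eventually_elim (simp add: det_mul)
    qed
  qed
qed

definition exchange_row :: "'n \<Rightarrow> 'n \<Rightarrow> 'a^'n^'n \<Rightarrow> 'a^'n^'n \<Rightarrow> 'a^'n^'n" where
  "exchange_row k i A B = (\<chi> l. if l = k then B $ i else A $ l)"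

lemma exchange_row_mult:
  fixes A B M :: "complex^'n^'n"
  shows "exchange_row k i A B ** M = exchange_row k i (A ** M) (B ** M)"
  by (simp add: exchange_row_def matrix_matrix_mult_def vec_eq_iff)

lemma tendsto_exchange_row:
  fixes A B :: "'a \<Rightarrow> complex^'n^'n"
  assumes "(A \<longlongrightarrow> a) F" "(B \<longlongrightarrow> b) F"
  shows "((\<lambda>x. exchange_row k i (A x) (B x)) \<longlongrightarrow> exchange_row k i a b) F"
  unfolding exchange_row_def
proof (rule tendsto_vec_lambda)
  fix l
  show "((\<lambda>x. if l = k then B x $ i else A x $ l) \<longlongrightarrow> (if l = k then b $ i else a $ l)) F"
    by (cases "l = k") (auto intro!: tendsto_intros assms)
qed

lemma det_exchange_row_mat:
  "det (exchange_row k i (mat 1) (mat 1 :: complex^'n^'n)) = (if i = k then 1 else 0)"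
proof (cases "i = k")
  case True
  then have "exchange_row k i (mat 1) (mat 1) = (mat 1 :: complex^'n^'n)"
    by (auto simp: exchange_row_def vec_eq_iff)
  then show ?thesis
    using True by simp
next
  case False
  then have "row i (exchange_row k i (mat 1) (mat 1 :: complex^'n^'n))
           = row k (exchange_row k i (mat 1) (mat 1))"
    by (auto simp: exchange_row_def row_def vec_eq_iff)
  then show ?thesis
    using False by (auto intro: det_identical_rows)
qed

text \<open>
  The jump acts from the right, hence on each row separately, so that rows of different solutions can
  be mixed.
\<close>

lemma jump_problem_exchange_row:
  fixes A B :: "complex \<Rightarrow> complex^'n^'n"
  assumes A: "jump_problem J D C A" and B: "jump_problem J D C' B"
  shows "jump_problem J D (exchange_row k i C C') (\<lambda>z. exchange_row k i (A z) (B z))"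
proof -
  from A obtain Ap Am N where
    A_hol: "\<And>i j. (\<lambda>z. A z $ i $ j) holomorphic_on (- unit_circle)"
    and A_cont: "continuous_on unit_circle Ap" "continuous_on unit_circle Am"
    and A_jump: "\<And>z. z \<in> unit_circle \<Longrightarrow>
      (A \<longlongrightarrow> Ap z) (at z within ball 0 1) \<and>
      (A \<longlongrightarrow> Am z) (at z within - cball 0 1) \<and> Ap z = Am z ** J z"
    and N: "(N \<longlongrightarrow> C) at_infinity" "\<forall>\<^sub>F z in at_infinity. A z = N z ** D z"
    unfolding jump_problem_def by blast
  from B obtain Bp Bm N' where
    B_hol: "\<And>i j. (\<lambda>z. B z $ i $ j) holomorphic_on (- unit_circle)"
    and B_cont: "continuous_on unit_circle Bp" "continuous_on unit_circle Bm"
    and B_jump: "\<And>z. z \<in> unit_circle \<Longrightarrow>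
      (B \<longlongrightarrow> Bp z) (at z within ball 0 1) \<and>
      (B \<longlongrightarrow> Bm z) (at z within - cball 0 1) \<and> Bp z = Bm z ** J z"
    and N': "(N' \<longlongrightarrow> C') at_infinity" "\<forall>\<^sub>F z in at_infinity. B z = N' z ** D z"
    unfolding jump_problem_def by blast
  show ?thesis
    unfolding jump_problem_def
  proof (intro conjI allI)
    show "(\<lambda>z. exchange_row k i (A z) (B z) $ p $ q) holomorphic_on - unit_circle" for p q
      by (cases "p = k") (simp_all add: exchange_row_def A_hol B_hol)
    show "\<exists>Mp Mm. continuous_on unit_circle Mp \<and> continuous_on unit_circle Mm \<and>
        (\<forall>z\<in>unit_circle.
           ((\<lambda>z. exchange_row k i (A z) (B z)) \<longlongrightarrow> Mp z) (at z within ball 0 1) \<and>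
           ((\<lambda>z. exchange_row k i (A z) (B z)) \<longlongrightarrow> Mm z) (at z within - cball 0 1) \<and>
           Mp z = Mm z ** J z)"
    proof (intro exI conjI ballI)
      show "continuous_on unit_circle (\<lambda>z. exchange_row k i (Ap z) (Bp z))"
        using A_cont B_cont by (auto simp: continuous_on_def intro: tendsto_exchange_row)
      show "continuous_on unit_circle (\<lambda>z. exchange_row k i (Am z) (Bm z))"
        using A_cont B_cont by (auto simp: continuous_on_def intro: tendsto_exchange_row)
      fix z :: complex
      assume z: "z \<in> unit_circle"
      note jumps = A_jump[OF z] B_jump[OF z]
      show "((\<lambda>z. exchange_row k i (A z) (B z)) \<longlongrightarrow> exchange_row k i (Ap z) (Bp z))
          (at z within ball 0 1)"
        using jumps by (intro tendsto_exchange_row) auto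
      show "((\<lambda>z. exchange_row k i (A z) (B z)) \<longlongrightarrow> exchange_row k i (Am z) (Bm z))
          (at z within - cball 0 1)"
        using jumps by (intro tendsto_exchange_row) auto
      show "exchange_row k i (Ap z) (Bp z) = exchange_row k i (Am z) (Bm z) ** J z"
        using jumps by (simp add: exchange_row_mult)
    qed
    show "\<exists>M. (M \<longlongrightarrow> exchange_row k i C C') at_infinity \<and>
        (\<forall>\<^sub>F z in at_infinity. exchange_row k i (A z) (B z) = M z ** D z)"
    proof (intro exI conjI)
      show "((\<lambda>z. exchange_row k i (N z) (N' z)) \<longlongrightarrow> exchange_row k i C C') at_infinity"
        by (rule tendsto_exchange_row[OF N(1) N'(1)])
      show "\<forall>\<^sub>F z in at_infinity.
          exchange_row k i (A z) (B z) = exchange_row k i (N z) (N' z) ** D z"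
        using N(2) N'(2) by eventually_elim (simp add: exchange_row_mult)
    qed
  qed
qed

text \<open>
  Write \<open>B = X ** A\<close>. Cramer's rule expresses the entries of \<open>X\<close> by determinants of \<open>A\<close> with one row
  exchanged, which settles uniqueness without any boundary values or asymptotics of the inverse
  matrix.
\<close>

theorem jump_problem_unique:
  fixes A B :: "complex \<Rightarrow> complex^'n^'n"
  assumes A: "jump_problem J D (mat 1) A" and B: "jump_problem J D (mat 1) B"
    and J: "\<And>z. z \<in> unit_circle \<Longrightarrow> det (J z) = 1"
    and D: "\<forall>\<^sub>F z in at_infinity. det (D z) = 1"
    and z: "z \<notin> unit_circle"
  shows "B z = A z"
proof -
  have "det (A z) = 1"
    using jump_problem_det[OF A J D z] by simp
  then obtain A' where A': "A' ** A z = mat 1"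
    by (metis invertible_det_nz invertible_def zero_neq_one)
  define X where "X = B z ** A'"
  have X: "B z = X ** A z"
    by (simp add: X_def A' flip: matrix_mul_assoc)
  have "X $ i $ k = (if i = k then 1 else 0)" for i k
  proof -
    have "row l (A z) = A z $ l" for l
      by (simp add: row_def)
    moreover have "(\<Sum>l\<in>UNIV. X $ i $ l *s A z $ l) = B z $ i"
      by (simp add: X matrix_matrix_mult_def vec_eq_iff)
    ultimately have "exchange_row k i (A z) (B z) =
        (\<chi> p. if p = k then \<Sum>l\<in>UNIV. X $ i $ l *s row l (A z) else row p (A z))"
      unfolding exchange_row_def by presburger
    then have "det (exchange_row k i (A z) (B z)) = X $ i $ k"
      using cramer_lemma_transpose[where A = "A z" and x = "X $ i" and k = k] \<open>det (A z) = 1\<close>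
      by simp
    moreover have "det (exchange_row k i (A z) (B z)) = (if i = k then 1 else 0)"
      using jump_problem_det[OF jump_problem_exchange_row[OF A B] J D z]
      by (simp add: det_exchange_row_mat)
    ultimately show ?thesis
      by simp
  qed
  then have "X = mat 1"
    by (simp add: mat_def vec_eq_iff)
  then show ?thesis
    using X by simp
qed


section \<open>The symmetry under reflection\<close>

definition shear :: "complex \<Rightarrow> complex^3^3" where
  "shear a = vector [vector [1, 0, 0], vector [a, 1, 0], vector [0, 0, 1]]"

abbreviation degree_matrix :: "int \<Rightarrow> complex \<Rightarrow> complex^3^3" where
  "degree_matrix m z \<equiv> diag3 (z powi (2 * m)) (z powi (2 * m - 2)) (z powi (- 4 * m + 2))"

lemma matrix_eq_3_iff:
  fixes A B :: "complex^3^3"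
  shows "A = B \<longleftrightarrow> (\<forall>i. A $ i $ 1 = B $ i $ 1 \<and> A $ i $ 2 = B $ i $ 2 \<and> A $ i $ 3 = B $ i $ 3)"
  by (simp add: vec_eq_iff forall_3)

lemma tendsto_shear:
  assumes "(f \<longlongrightarrow> a) F"
  shows "((\<lambda>x. shear (f x)) \<longlongrightarrow> shear a) F"
proof (intro vec_tendstoI)
  fix i j :: 3
  show "((\<lambda>x. shear (f x) $ i $ j) \<longlongrightarrow> shear a $ i $ j) F"
    using exhaust_3[of i] exhaust_3[of j] assms by (auto simp: shear_def)
qed

lemma shear_0: "shear 0 = mat 1"
  by (simp add: shear_def mat_def matrix_eq_3_iff forall_3)

lemma det_jump_matrix: "det (jump_matrix w m r z) = 1"
  by (simp add: det_3 jump_matrix_def)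

lemma det_degree_matrix:
  assumes "z \<noteq> 0"
  shows "det (degree_matrix m z) = 1"
proof -
  have "det (diag3 a b c) = a * b * c" for a b c
    by (simp add: det_3 diag3_def)
  then have "det (degree_matrix m z) =
      z powi (2 * m) * z powi (2 * m - 2) * z powi (- 4 * m + 2)" .
  also have "\<dots> = z powi (2 * m + (2 * m - 2) + (- 4 * m + 2))"
    by (subst (1 2) power_int_add) (use assms in simp_all)
  finally show ?thesis
    by simp
qed

lemma degree_matrix_uminus: "degree_matrix m (- z) = degree_matrix m z"
  by (simp add: power_int_minus_left)

text \<open>
  The first diagonal entry exceeds the second by the factor \<open>z\<^sup>2\<close>; this is what makes the shear
  disappear in the limit at infinity.
\<close>

lemma degree_matrix_mult_shear:
  assumes "z \<noteq> 0"
  shows "degree_matrix m z ** shear (2 * z) = shear (2 / z) ** degree_matrix m z"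
proof -
  have "z powi (2 * m) = z powi (2 * m - 2) * z\<^sup>2"
    using assms power_int_add[of z "2 * m - 2" 2] by simp
  then show ?thesis
    using assms
    by (simp add: matrix_eq_3_iff forall_3 diag3_def shear_def matrix_matrix_mult_def sum_3
        power2_eq_square)
qed

lemma j1_uminus: "j1 w m r (- z) = j1 w m r z"
proof (cases "even r")
  case True
  then show ?thesis by (simp add: j1_def power_int_minus_left algebra_simps)
next
  case False
  then show ?thesis by (simp add: j1_def power_int_minus_left algebra_simps)
qed

lemma j2_uminus:
  assumes "z \<noteq> 0"
  shows "j2 w m r (- z) = 2 * z * j1 w m r z + j2 w m r z"
proof -
  have "z powi (- 4 * m - r + 5) = z * z powi (- 4 * m - r + 4)"
    using assms power_int_add[of z 1 "- 4 * m - r + 4"] by (simp add: algebra_simps)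
  then show ?thesis
    by (cases "even r") (simp_all add: j1_def j2_def power_int_minus_left algebra_simps)
qed

lemma jump_matrix_uminus_mult_shear:
  assumes "z \<noteq> 0"
  shows "jump_matrix w m r (- z) ** shear (2 * z) = shear (2 * z) ** jump_matrix w m r z"
  using j1_uminus[of w m r z] j2_uminus[OF assms, of w m r]
  by (simp add: matrix_eq_3_iff forall_3 jump_matrix_def shear_def matrix_matrix_mult_def sum_3)

lemma jump_problem_if_solves_rhp:
  assumes "solves_rhp w m r Y"
  shows "jump_problem (jump_matrix w m r) (degree_matrix m) (mat 1) Y"
proof -
  from assms obtain Y1 Y2 E where
    E: "\<And>i j. (\<lambda>z. E z $ i $ j) \<in> O[at_infinity](\<lambda>z. z powi (- 3))"
    and Y: "\<forall>\<^sub>F z in at_infinity.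
           Y z = (mat 1 + mat (1 / z) ** Y1 + mat (1 / z\<^sup>2) ** Y2 + E z) ** degree_matrix m z"
    unfolding solves_rhp_def rhp_asymptotics_def by blast
  have powers: "((\<lambda>z. 1 / z ^ n :: complex) \<longlongrightarrow> 0) at_infinity" if "n > 0" for n :: nat
    using that
    by (intro tendsto_divide_0[OF tendsto_const] filterlim_power_at_infinity filterlim_ident) simp
  have mat_lim: "((\<lambda>z. mat (1 / z ^ n) ** M) \<longlongrightarrow> 0) at_infinity" if "n > 0"
    for n :: nat and M :: "complex^3^3"
  proof -
    have "((\<lambda>z. mat (1 / z ^ n) :: complex^3^3) \<longlongrightarrow> 0) at_infinity"
    proof (intro vec_tendstoI)
      fix i j :: 3
      show "((\<lambda>z. (mat (1 / z ^ n) :: complex^3^3) $ i $ j) \<longlongrightarrow> 0 $ i $ j) at_infinity"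
        by (cases "i = j") (use powers[OF that] in \<open>simp_all add: mat_def\<close>)
    qed
    from tendsto_matrix_mult[OF this tendsto_const] show ?thesis
      by simp
  qed
  have "(E \<longlongrightarrow> 0) at_infinity"
  proof (intro vec_tendstoI)
    fix i j :: 3
    have "((\<lambda>z. z powi (- 3) :: complex) \<longlongrightarrow> 0) at_infinity"
      using powers[of 3] by (simp add: power_int_minus divide_inverse)
    then have "(\<lambda>z. z powi (- 3) :: complex) \<in> o[at_infinity](\<lambda>_. 1)"
      by (intro smalloI_tendsto) simp_all
    with E have "(\<lambda>z. E z $ i $ j) \<in> o[at_infinity](\<lambda>_. 1)"
      by (rule landau_o.big_small_trans)
    from smalloD_tendsto[OF this] have "((\<lambda>z. E z $ i $ j) \<longlongrightarrow> 0) at_infinity"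
      by simp
    then show "((\<lambda>z. E z $ i $ j) \<longlongrightarrow> 0 $ i $ j) at_infinity"
      by simp
  qed
  then have "((\<lambda>z. mat 1 + mat (1 / z) ** Y1 + mat (1 / z\<^sup>2) ** Y2 + E z) \<longlongrightarrow> mat 1 + 0 + 0 + 0)
      at_infinity"
    using mat_lim[of 1] mat_lim[of 2] by (intro tendsto_add tendsto_const) simp_all
  then have "((\<lambda>z. mat 1 + mat (1 / z) ** Y1 + mat (1 / z\<^sup>2) ** Y2 + E z) \<longlongrightarrow> mat 1) at_infinity"
    by simp
  with Y have "\<exists>N. (N \<longlongrightarrow> mat 1) at_infinity \<and>
      (\<forall>\<^sub>F z in at_infinity. Y z = N z ** degree_matrix m z)"
    by blast
  then show ?thesis
    using assms unfolding jump_problem_def solves_rhp_def rhp_holomorphic_def rhp_jump_def by blast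
qed

lemma filterlim_uminus_at_within:
  fixes z :: complex
  assumes "uminus ` S \<subseteq> S"
  shows "filterlim uminus (at (- z) within S) (at z within S)"
  unfolding filterlim_at
proof
  show "\<forall>\<^sub>F x in at z within S. - x \<in> S \<and> - x \<noteq> - z"
    using assms unfolding eventually_at_filter by (intro always_eventually) auto
  show "(uminus \<longlongrightarrow> - z) (at z within S)"
    by (rule tendsto_minus[OF tendsto_ident_at])
qed

theorem jump_problem_reflect:
  assumes "jump_problem (jump_matrix w m r) (degree_matrix m) (mat 1) Y"
  shows "jump_problem (jump_matrix w m r) (degree_matrix m) (mat 1)
           (\<lambda>z. Y (- z) ** shear (2 * z))"
proof -
  let ?J = "jump_matrix w m r" and ?S = "\<lambda>z. shear (2 * z)"
  from assms obtain Yp Ym N where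
    hol: "\<And>i j. (\<lambda>z. Y z $ i $ j) holomorphic_on (- unit_circle)"
    and cont: "continuous_on unit_circle Yp" "continuous_on unit_circle Ym"
    and jump: "\<And>z. z \<in> unit_circle \<Longrightarrow>
      (Y \<longlongrightarrow> Yp z) (at z within ball 0 1) \<and>
      (Y \<longlongrightarrow> Ym z) (at z within - cball 0 1) \<and> Yp z = Ym z ** ?J z"
    and N: "(N \<longlongrightarrow> mat 1) at_infinity" "\<forall>\<^sub>F z in at_infinity. Y z = N z ** degree_matrix m z"
    unfolding jump_problem_def by blast
  have S_lim: "(?S \<longlongrightarrow> ?S z) (at z within T)" for z T
    by (intro tendsto_shear tendsto_intros)
  have cont_reflect: "continuous_on unit_circle (\<lambda>z. B (- z) ** ?S z)"
    if "continuous_on unit_circle B" for B :: "complex \<Rightarrow> complex^3^3"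
  proof (rule continuous_on_matrix_mult)
    show "continuous_on unit_circle (\<lambda>z. B (- z))"
      by (rule continuous_on_compose2[OF that]) (auto intro!: continuous_intros)
    show "continuous_on unit_circle ?S"
      by (simp add: continuous_on_def S_lim)
  qed
  have lim_reflect: "((\<lambda>z. Y (- z) ** ?S z) \<longlongrightarrow> L ** ?S z) (at z within T)"
    if "(Y \<longlongrightarrow> L) (at (- z) within T)" "uminus ` T \<subseteq> T" for L z T
    by (intro tendsto_matrix_mult S_lim filterlim_compose[OF that(1)]
        filterlim_uminus_at_within that(2))
  have at_inf: "filterlim (uminus :: complex \<Rightarrow> complex) at_infinity at_infinity"
    by (simp add: filterlim_at_infinity_conv_norm_at_top filterlim_norm_at_top)
  show ?thesis
    unfolding jump_problem_def
  proof (intro conjI allI)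
    fix i j :: 3
    have reflect: "(\<lambda>z. Y (- z) $ p $ q) holomorphic_on - unit_circle" for p q
    proof -
      have "((\<lambda>z. Y z $ p $ q) \<circ> uminus) holomorphic_on - unit_circle"
        by (rule holomorphic_on_compose_gen[OF _ hol[of p q]]) (auto intro: holomorphic_intros)
      then show ?thesis
        by (simp add: comp_def)
    qed
    have "(\<lambda>z. ?S z $ k $ j) holomorphic_on - unit_circle" for k
      using exhaust_3[of k] exhaust_3[of j] by (auto simp: shear_def intro!: holomorphic_intros)
    then show "(\<lambda>z. (Y (- z) ** ?S z) $ i $ j) holomorphic_on - unit_circle"
      unfolding matrix_matrix_mult_def by (simp, intro holomorphic_intros reflect)
  next
    show "\<exists>Zp Zm. continuous_on unit_circle Zp \<and> continuous_on unit_circle Zm \<and>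
        (\<forall>z\<in>unit_circle.
           ((\<lambda>z. Y (- z) ** ?S z) \<longlongrightarrow> Zp z) (at z within ball 0 1) \<and>
           ((\<lambda>z. Y (- z) ** ?S z) \<longlongrightarrow> Zm z) (at z within - cball 0 1) \<and>
           Zp z = Zm z ** ?J z)"
    proof (intro exI conjI ballI)
      show "continuous_on unit_circle (\<lambda>z. Yp (- z) ** ?S z)"
        "continuous_on unit_circle (\<lambda>z. Ym (- z) ** ?S z)"
        by (rule cont_reflect[OF cont(1)], rule cont_reflect[OF cont(2)])
      fix z :: complex
      assume z: "z \<in> unit_circle"
      then have neg: "- z \<in> unit_circle" and "z \<noteq> 0"
        by auto
      show "((\<lambda>z. Y (- z) ** ?S z) \<longlongrightarrow> Yp (- z) ** ?S z) (at z within ball 0 1)"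
        by (rule lim_reflect) (use jump[OF neg] in auto)
      show "((\<lambda>z. Y (- z) ** ?S z) \<longlongrightarrow> Ym (- z) ** ?S z) (at z within - cball 0 1)"
        by (rule lim_reflect) (use jump[OF neg] in auto)
      have "Yp (- z) ** ?S z = Ym (- z) ** (?J (- z) ** ?S z)"
        using jump[OF neg] by (simp add: matrix_mul_assoc)
      also have "\<dots> = Ym (- z) ** ?S z ** ?J z"
        using \<open>z \<noteq> 0\<close> by (simp add: jump_matrix_uminus_mult_shear matrix_mul_assoc)
      finally show "Yp (- z) ** ?S z = Ym (- z) ** ?S z ** ?J z" .
    qed
  next
    show "\<exists>M. (M \<longlongrightarrow> mat 1) at_infinity \<and>
        (\<forall>\<^sub>F z in at_infinity. Y (- z) ** ?S z = M z ** degree_matrix m z)"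
    proof (intro exI conjI)
      have "((\<lambda>z. 2 / z :: complex) \<longlongrightarrow> 0) at_infinity"
        by (intro tendsto_divide_0[OF tendsto_const] filterlim_ident)
      from tendsto_matrix_mult[OF filterlim_compose[OF N(1) at_inf] tendsto_shear[OF this]]
      show "((\<lambda>z. N (- z) ** shear (2 / z)) \<longlongrightarrow> mat 1) at_infinity"
        by (simp add: shear_0)
      have "\<forall>\<^sub>F z in at_infinity. Y (- z) = N (- z) ** degree_matrix m (- z)"
        using at_inf N(2) unfolding filterlim_iff by blast
      moreover have "\<forall>\<^sub>F z in at_infinity. (z :: complex) \<noteq> 0"
        by (rule eventually_not_equal_at_infinity)
      ultimately show "\<forall>\<^sub>F z in at_infinity.
          Y (- z) ** ?S z = N (- z) ** shear (2 / z) ** degree_matrix m z"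
      proof eventually_elim
        case (elim z)
        have "Y (- z) ** ?S z = N (- z) ** (degree_matrix m z ** ?S z)"
          using elim(1) by (simp only: degree_matrix_uminus matrix_mul_assoc)
        also have "\<dots> = N (- z) ** shear (2 / z) ** degree_matrix m z"
          by (simp only: degree_matrix_mult_shear[OF elim(2)] matrix_mul_assoc)
        finally show ?case .
      qed
    qed
  qed
qed

theorem lemma2:
  fixes w :: "complex \<Rightarrow> complex" and m r :: int and Y :: "complex \<Rightarrow> complex^3^3"
  assumes "m \<ge> 1"
    and "solves_rhp w m r Y"
  shows "(\<forall>z. z \<notin> unit_circle \<longrightarrow>
            Y z = Y (- z) ** vector [vector [1, 0, 0], vector [2 * z, 1, 0], vector [0, 0, 1]]) \<and>
         (\<forall>z j. z \<notin> unit_circle \<longrightarrow> z \<noteq> 0 \<longrightarrow>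
            Y z $ j $ 2 = (Y z $ j $ 1 - Y (- z) $ j $ 1) / (2 * z))"
proof -
  note Y = jump_problem_if_solves_rhp[OF assms(2)]
  have "\<forall>\<^sub>F z in at_infinity. det (degree_matrix m z) = 1"
    using eventually_not_equal_at_infinity[of 0] by eventually_elim (rule det_degree_matrix)
  then have reflect: "Y z = Y (- z) ** shear (2 * z)" if "z \<notin> unit_circle" for z
    using jump_problem_unique[OF Y jump_problem_reflect[OF Y] det_jump_matrix _ that] by simp
  have "Y z $ j $ 2 = (Y z $ j $ 1 - Y (- z) $ j $ 1) / (2 * z)"
    if "z \<notin> unit_circle" "z \<noteq> 0" for z j
  proof -
    have "Y z $ j $ 1 = Y (- z) $ j $ 1 + Y (- z) $ j $ 2 * (2 * z)"
      "Y z $ j $ 2 = Y (- z) $ j $ 2"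
      using reflect[OF that(1)] by (simp_all add: matrix_matrix_mult_def sum_3 shear_def)
    then show ?thesis
      using that(2) by simp
  qed
  then show ?thesis
    using reflect unfolding shear_def by blast
qed

end
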